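(* Let $G$ be the graph on the $16$ vertices $u_i,b_i,o_i,r_i$ ($0\le i\le 3$) whose edge set is the union of the edge sets of the following eight complete graphs $K_4$: the complete graph on $\{u_0,u_1,u_2,u_3\}$; for each $i\in\{0,1,2,3\}$, the complete graph on $\{u_i,b_i,o_i,r_i\}$; the complete graph on $\{b_0,b_1,b_2,b_3\}$; the complete graph on $\{o_0,o_1,o_2,o_3\}$; and the complete graph on $\{r_0,r_1,r_2,r_3\}$. Then $G$ contains no copy of $\widehat P_4$ and $G$ has exactly $32=\lfloor 16^2/8\rfloor$ triangles; in particular $G$ is an extremal graph for $\mathrm{ex}(16,K_3,\widehat P_4)$ that contains a $K_4$.
   Context: All graphs are finite and simple. $P_4$ denotes the path on $4$ vertices. For a graph $G$, its suspension $\widehat G$ is the graph obtained from $G$ by adding one new vertex and joining it to every vertex of $G$. "Contains a copy of $H$" means contains a subgraph (not necessarily induced) isomorphic to $H$. $\mathrm{ex}(n,K_3,H)$ denotes the maximum number of triangles in an $n$-vertex graph containing no copy of $H$. *)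

theory Defs
  imports Main
begin

type_synonym 'a graph = "'a set \<times> 'a set set"

definition complete_on :: "'a set \<Rightarrow> 'a set set" where
  "complete_on S = {{x, y} | x y. x \<in> S \<and> y \<in> S \<and> x \<noteq> y}"

definition K :: "nat \<Rightarrow> nat graph" where
  "K n = ({0..<n}, complete_on {0..<n})"

definition P :: "nat \<Rightarrow> nat graph" where
  "P n = ({0..<n}, {{i, Suc i} | i. Suc i < n})"

definition suspension :: "'a graph \<Rightarrow> 'a option graph" where
  "suspension G = (insert None (Some ` fst G),
      ((`) Some) ` snd G \<union> {{None, Some v} | v. v \<in> fst G})"

definition contains_copy :: "'a graph \<Rightarrow> 'b graph \<Rightarrow> bool" where
  "contains_copy G H \<longleftrightarrow> (\<exists>f. inj_on f (fst H) \<and> f ` fst H \<subseteq> fst G \<and>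
      (\<forall>e \<in> snd H. f ` e \<in> snd G))"

definition triangles :: "'a graph \<Rightarrow> 'a set set" where
  "triangles G = {T. T \<subseteq> fst G \<and> card T = 3 \<and>
      (\<forall>x \<in> T. \<forall>y \<in> T. x \<noteq> y \<longrightarrow> {x, y} \<in> snd G)}"

text \<open>The 16-vertex graph: vertex (c, i) stands for u_i, b_i, o_i, r_i.\<close>
datatype colour = cU | cB | cO | cR

definition G16 :: "(colour \<times> nat) graph" where
  "G16 = (UNIV \<times> {0..<4},
     complete_on {(cU, i) | i. i < 4}
     \<union> (\<Union>i \<in> {0..<4}. complete_on {(cU, i), (cB, i), (cO, i), (cR, i)})
     \<union> complete_on {(cB, i) | i. i < 4}
     \<union> complete_on {(cO, i) | i. i < 4}
     \<union> complete_on {(cR, i) | i. i < 4})"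

end

theory Submission
  imports Defs
begin

text \<open>G16 is the rook's graph on a 4 \<times> 4 board: two vertices are adjacent iff they agree
  in the colour or in the index. Its eight lines (four rows of one colour, four columns of one
  index) are 4-cliques, any two of which share at most one vertex, and every triangle lies in
  a line; hence the triangles are the 3-subsets of lines, 8 \<cdot> 4 = 32 of them. In a copy of the
  suspension of P4 with apex c and path a0 a1 a2 a3, each triangle c a_k a_(k+1) lies in a line,
  and consecutive such lines share the two vertices c and a_(k+1), so they coincide: all five
  vertices lie in one line, which has only four.\<close>

lemma UNIV_colour: "(UNIV :: colour set) = {cU, cB, cO, cR}"
  using colour.exhaust by auto

lemma finite_UNIV_colour [simp]: "finite (UNIV :: colour set)"
  by (simp add: UNIV_colour)

lemma card_UNIV_colour: "card (UNIV :: colour set) = 4"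
  by (simp add: UNIV_colour)

lemma doubleton_in_complete_on_iff:
  "{x, y} \<in> complete_on S \<longleftrightarrow> x \<noteq> y \<and> x \<in> S \<and> y \<in> S"
  unfolding complete_on_def by (auto simp: doubleton_eq_iff)

lemma fst_G16: "fst G16 = UNIV \<times> {0..<4}"
  by (simp add: G16_def)

lemma edge_G16_iff:
  "{x, y} \<in> snd G16 \<longleftrightarrow>
     x \<noteq> y \<and> snd x < 4 \<and> snd y < 4 \<and> (fst x = fst y \<or> snd x = snd y)"
  by (cases x; cases y; cases "fst x"; cases "fst y")
     (auto simp: G16_def doubleton_in_complete_on_iff)

definition line :: "colour + nat \<Rightarrow> (colour \<times> nat) set" where
  "line l = (case l of Inl c \<Rightarrow> {c} \<times> {0..<4} | Inr i \<Rightarrow> UNIV \<times> {i})"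

definition line_ids :: "(colour + nat) set" where
  "line_ids = range Inl \<union> Inr ` {0..<4}"

lemma finite_line: "finite (line l)"
  by (cases l) (auto simp: line_def)

lemma card_line: "l \<in> line_ids \<Longrightarrow> card (line l) = 4"
  by (auto simp: line_def line_ids_def card_cartesian_product card_UNIV_colour)

lemma card_line_ids: "card line_ids = 8"
proof -
  have "card line_ids =
      card (range Inl :: (colour + nat) set) + card (Inr ` {0..<4::nat} :: (colour + nat) set)"
    unfolding line_ids_def by (rule card_Un_disjoint) (auto simp: UNIV_colour)
  also have "\<dots> = 8"
    by (simp add: card_image card_UNIV_colour)
  finally show ?thesis .
qed

lemma line_unique:
  assumes "l \<in> line_ids" "m \<in> line_ids" "x \<noteq> y"
    and "x \<in> line l" "y \<in> line l" "x \<in> line m" "y \<in> line m"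
  shows "l = m"
  using assms by (cases l; cases m) (auto simp: line_def line_ids_def prod_eq_iff)

lemma edge_G16_if_collinear:
  assumes "l \<in> line_ids" "x \<in> line l" "y \<in> line l" "x \<noteq> y"
  shows "{x, y} \<in> snd G16"
  using assms by (cases l) (auto simp: line_def line_ids_def edge_G16_iff)

lemma triangle_G16_collinear:
  assumes "{x, y} \<in> snd G16" "{x, z} \<in> snd G16" "{y, z} \<in> snd G16"
  obtains l where "l \<in> line_ids" "x \<in> line l" "y \<in> line l" "z \<in> line l"
proof -
  have "(fst y = fst x \<and> fst z = fst x) \<or> (snd y = snd x \<and> snd z = snd x)"
    using assms by (cases x; cases y; cases z) (auto simp: edge_G16_iff)
  then show thesis
  proof
    assume "fst y = fst x \<and> fst z = fst x"
    with assms show thesis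
      by (intro that[of "Inl (fst x)"]) (auto simp: line_def line_ids_def edge_G16_iff mem_Times_iff)
  next
    assume "snd y = snd x \<and> snd z = snd x"
    with assms show thesis
      by (intro that[of "Inr (snd x)"]) (auto simp: line_def line_ids_def edge_G16_iff mem_Times_iff)
  qed
qed

lemma path_in_neighbourhood_G16_collinear:
  assumes "2 \<le> n"
    and apex: "\<And>k. k < n \<Longrightarrow> {c, a k} \<in> snd G16"
    and path: "\<And>k. Suc k < n \<Longrightarrow> {a k, a (Suc k)} \<in> snd G16"
  obtains l where "l \<in> line_ids" "c \<in> line l" "a ` {0..<n} \<subseteq> line l"
proof -
  obtain l where l: "l \<in> line_ids" "c \<in> line l" "a 0 \<in> line l"
    using triangle_G16_collinear[OF apex apex path, of 0] assms(1) by auto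
  have "a k \<in> line l" if "k < n" for k
    using that
  proof (induction k)
    case 0
    show ?case using l by simp
  next
    case (Suc k)
    obtain m where m: "m \<in> line_ids" "c \<in> line m" "a k \<in> line m" "a (Suc k) \<in> line m"
      using triangle_G16_collinear[OF apex apex path, of k] Suc.prems by auto
    have "c \<noteq> a k"
      using apex[of k] Suc.prems by (auto simp: edge_G16_iff)
    moreover have "a k \<in> line l"
      using Suc by simp
    ultimately have "m = l"
      using line_unique[OF m(1) l(1) _ m(2,3) l(2)] by blast
    then show ?case using m by simp
  qed
  then have "a ` {0..<n} \<subseteq> line l" by auto
  with l that show thesis by blast
qed

lemma contains_copy_suspension_P_E:
  assumes "contains_copy G (suspension (P n))"
  obtains a c where "inj_on a {0..<n}" "c \<notin> a ` {0..<n}"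
    "\<And>k. k < n \<Longrightarrow> {c, a k} \<in> snd G"
    "\<And>k. Suc k < n \<Longrightarrow> {a k, a (Suc k)} \<in> snd G"
proof -
  obtain f where inj: "inj_on f (fst (suspension (P n)))"
    and edges: "\<forall>e \<in> snd (suspension (P n)). f ` e \<in> snd G"
    using assms unfolding contains_copy_def by blast
  have V: "fst (suspension (P n)) = insert None (Some ` {0..<n})"
    by (simp add: suspension_def P_def)
  show thesis
  proof (rule that)
    show "inj_on (f \<circ> Some) {0..<n}"
      using inj unfolding V by (auto simp: inj_on_def)
    show "f None \<notin> (f \<circ> Some) ` {0..<n}"
      using inj unfolding V by (auto simp: inj_on_def)
    show "{f None, (f \<circ> Some) k} \<in> snd G" if "k < n" for k
    proof -
      have "{None, Some k} \<in> snd (suspension (P n))"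
        using that unfolding suspension_def P_def by auto
      then show ?thesis using edges by force
    qed
    show "{(f \<circ> Some) k, (f \<circ> Some) (Suc k)} \<in> snd G" if "Suc k < n" for k
    proof -
      have "{k, Suc k} \<in> snd (P n)"
        using that by (auto simp: P_def)
      then have "Some ` {k, Suc k} \<in> snd (suspension (P n))"
        unfolding suspension_def snd_conv by blast
      then show ?thesis using edges by auto
    qed
  qed
qed

lemma not_contains_copy_G16_suspension_P:
  assumes "4 \<le> n"
  shows "\<not> contains_copy G16 (suspension (P n))"
proof
  assume "contains_copy G16 (suspension (P n))"
  then obtain c a where inj: "inj_on a {0..<n}" and c: "c \<notin> a ` {0..<n}"
    and apex: "\<And>k. k < n \<Longrightarrow> {c, a k} \<in> snd G16"
    and path: "\<And>k. Suc k < n \<Longrightarrow> {a k, a (Suc k)} \<in> snd G16"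
    by (rule contains_copy_suspension_P_E) blast
  have "2 \<le> n" using assms by simp
  then obtain l where "l \<in> line_ids" "c \<in> line l" "a ` {0..<n} \<subseteq> line l"
    using apex path by (rule path_in_neighbourhood_G16_collinear) blast
  then have l: "l \<in> line_ids" "insert c (a ` {0..<n}) \<subseteq> line l"
    by auto
  have "n + 1 = card (insert c (a ` {0..<n}))"
    using inj c by (simp add: card_image)
  also have "\<dots> \<le> card (line l)"
    using l(2) by (rule card_mono[OF finite_line])
  also have "\<dots> = 4"
    using l(1) by (rule card_line)
  finally show False using assms by simp
qed

lemma triangles_G16_eq:
  "triangles G16 = (\<Union>l \<in> line_ids. {T. T \<subseteq> line l \<and> card T = 3})"
proof (intro equalityI subsetI)
  fix T assume "T \<in> triangles G16"
  then have card_T: "card T = 3"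
    and edges: "\<forall>x \<in> T. \<forall>y \<in> T. x \<noteq> y \<longrightarrow> {x, y} \<in> snd G16"
    by (auto simp: triangles_def)
  then obtain x y z where T: "T = {x, y, z}" "x \<noteq> y" "x \<noteq> z" "y \<noteq> z"
    by (auto simp: card_3_iff)
  obtain l where "l \<in> line_ids" "x \<in> line l" "y \<in> line l" "z \<in> line l"
    using triangle_G16_collinear edges T by (metis insertCI)
  then show "T \<in> (\<Union>l \<in> line_ids. {T. T \<subseteq> line l \<and> card T = 3})"
    using T card_T by auto
next
  fix T assume "T \<in> (\<Union>l \<in> line_ids. {T. T \<subseteq> line l \<and> card T = 3})"
  then obtain l where l: "l \<in> line_ids" "T \<subseteq> line l" "card T = 3"
    by auto
  have "line l \<subseteq> fst G16"
    using l(1) by (auto simp: line_def line_ids_def fst_G16)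
  with l show "T \<in> triangles G16"
    unfolding triangles_def by (auto intro: edge_G16_if_collinear)
qed

lemma card_triangles_G16: "card (triangles G16) = 32"
proof -
  have "card (triangles G16) = (\<Sum>l \<in> line_ids. card {T. T \<subseteq> line l \<and> card T = 3})"
    unfolding triangles_G16_eq
  proof (rule card_UN_disjoint)
    show "finite line_ids"
      by (simp add: line_ids_def)
    show "\<forall>l \<in> line_ids. finite {T. T \<subseteq> line l \<and> card T = 3}"
      by (simp add: finite_line)
    show "\<forall>l \<in> line_ids. \<forall>m \<in> line_ids. l \<noteq> m \<longrightarrow>
        {T. T \<subseteq> line l \<and> card T = 3} \<inter> {T. T \<subseteq> line m \<and> card T = 3} = {}"
    proof (intro ballI impI equals0I)
      fix l m T
      assume "l \<in> line_ids" "m \<in> line_ids" "l \<noteq> m"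
        and "T \<in> {T. T \<subseteq> line l \<and> card T = 3} \<inter> {T. T \<subseteq> line m \<and> card T = 3}"
      moreover obtain x y z where "T = {x, y, z}" "x \<noteq> y" "x \<noteq> z" "y \<noteq> z"
        using calculation(4) by (auto simp: card_3_iff)
      ultimately show False
        using line_unique[of l m x y] by auto
    qed
  qed
  also have "\<dots> = (\<Sum>l \<in> line_ids. 4 choose 3)"
    by (rule sum.cong) (simp_all add: n_subsets finite_line card_line)
  also have "\<dots> = 32"
    by (simp add: card_line_ids numeral_eq_Suc)
  finally show ?thesis .
qed

lemma contains_copy_G16_K4: "contains_copy G16 (K 4)"
  unfolding contains_copy_def K_def
proof (intro exI[of _ "\<lambda>i. (cU, i)"] conjI ballI)
  show "inj_on (\<lambda>i. (cU, i)) (fst ({0..<4}, complete_on {0..<4}))"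
    by (simp add: inj_on_def)
  show "(\<lambda>i. (cU, i)) ` fst ({0..<4::nat}, complete_on {0..<4}) \<subseteq> fst G16"
    by (auto simp: fst_G16)
  fix e :: "nat set" assume "e \<in> snd ({0..<4::nat}, complete_on {0..<4})"
  then show "(\<lambda>i. (cU, i)) ` e \<in> snd G16"
    by (auto simp: complete_on_def edge_G16_iff)
qed

theorem mainTheorem3:
  shows "\<not> contains_copy G16 (suspension (P 4))
    \<and> card (triangles G16) = 32 \<and> (32::nat) = 16^2 div 8
    \<and> contains_copy G16 (K 4)"
  using not_contains_copy_G16_suspension_P card_triangles_G16 contains_copy_G16_K4 by simp

end
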